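(* Let $0 \leq \mu < 1 \leq M < \infty$ be arbitrary real numbers and let $\mathscr{R}_M := \{z \in \mathbb{C} : |1-z| \leq M(1-|z|)\}$. There exist constants $C_1 = C_1(\mu,M) > 0$ and $C_2 = C_2(\mu,M) > 0$, depending only on $\mu$ and $M$, such that for any power series $$f(z) = \sum_{n=0}^\infty a_n z^n, \qquad a_n \in [-\mu,\mu] \subset \mathbb{R} \text{ for all } n \ge 0,$$ there exists a power series with $\pm 1$ coefficients $$Q(z) = \sum_{n=0}^\infty q_n z^n, \qquad q_n \in \{-1,+1\} \text{ for all } n \ge 0,$$ which satisfies $$|f(z) - Q(z)| < C_1 e^{-C_2/|1-z|}$$ for all $z \in \mathscr{R}_M \setminus \{1\}$.
   Context: The set $\mathscr{R}_M \setminus \{1\}$ is contained in the open unit disc, where both power series converge. *)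

theory Defs
  imports "HOL-Analysis.Analysis"
begin

definition stolz_region :: "real \<Rightarrow> complex set" where
  "stolz_region M = {z. cmod (1 - z) \<le> M * (1 - cmod z)}"

definition real_power_series :: "(nat \<Rightarrow> real) \<Rightarrow> complex \<Rightarrow> complex" where
  "real_power_series a z = (\<Sum>n. complex_of_real (a n) * z ^ n)"

text \<open>The following two facts ensure that \<^const>\<open>suminf\<close> is only ever applied to
  convergent series when \<^const>\<open>real_power_series\<close> is evaluated on a Stolz region without its
  vertex and the coefficients are bounded.\<close>

lemma stolz_region_subset_disc:
  assumes "M \<ge> 1"
  shows "stolz_region M - {1} \<subseteq> ball 0 1"
proof
  fix z assume z: "z \<in> stolz_region M - {1}"
  then have "0 < cmod (1 - z)" by simp
  also have "\<dots> \<le> M * (1 - cmod z)" using z by (simp add: stolz_region_def)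
  finally have "0 < M * (1 - cmod z)" .
  with assms show "z \<in> ball 0 1" by (simp add: zero_less_mult_iff)
qed

lemma summable_real_power_series:
  assumes "\<And>n. \<bar>a n\<bar> \<le> B" and "cmod z < 1"
  shows "summable (\<lambda>n. complex_of_real (a n) * z ^ n)"
proof (rule summable_comparison_test')
  show "summable (\<lambda>n. B * cmod z ^ n)"
    using assms(2) by (intro summable_mult summable_geometric) simp
  show "norm (complex_of_real (a n) * z ^ n) \<le> B * cmod z ^ n" if "n \<ge> 0" for n
    using assms(1)[of n] by (simp add: norm_mult norm_power mult_right_mono)
qed

end

theory Submission
  imports Defs "HOL-Complex_Analysis.Complex_Analysis"
begin

text \<open>
  The approximation is produced by one-bit noise-shaping quantization. Fix a real power series
  \<open>G(z) = \<Sum> g\<^sub>n z\<^sup>n\<close> with \<open>g\<^sub>0 = 1\<close>, and try to solve the convolution equation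
  \<open>a - q = g * u\<close> for signs \<open>q\<^sub>n\<close> and a bounded state sequence \<open>u\<^sub>n\<close>. Since \<open>g\<^sub>0 = 1\<close>,
  the equation reads \<open>u\<^sub>n = (a\<^sub>n - \<Sum>\<^sub>k\<^sub><\<^sub>n u\<^sub>k g\<^sub>n\<^sub>-\<^sub>k) - q\<^sub>n\<close>, and choosing \<open>q\<^sub>n\<close> to be the sign of
  the bracket keeps \<open>\<bar>u\<^sub>n\<bar> \<le> 1\<close> for ever as soon as the bracket stays in \<open>[-2, 2]\<close>. This holds if
  \<open>\<mu> + \<Sum>\<^sub>n\<^sub>\<ge>\<^sub>1 \<bar>g\<^sub>n\<bar> \<le> 2\<close>, that is, if the total absolute sum of \<open>g\<close> is at most \<open>3 - \<mu>\<close>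
  (\<open>exists_one_bit_quantization\<close>). On the level of power series \<open>f - Q = G U\<close> with
  \<open>\<bar>U(z)\<bar> \<le> 1 / (1 - \<bar>z\<bar>) \<le> M / \<bar>1 - z\<bar>\<close> on the Stolz region, so everything depends on finding a
  filter \<open>G\<close> that is small near 1.

  The filter is \<open>G(z) = P(z) exp (- c z / (1 - z))\<close>. The exponential is a singular inner function up
  to a constant; on the Stolz region \<open>Re (1 / (1 - z)) \<ge> 1 / (M \<bar>1 - z\<bar>)\<close>, so it has exactly the decay
  that is claimed. Two facts make the absolute coefficient sum of \<open>G\<close> small enough, where the margin
  available is \<open>1 - \<mu> > 0\<close> above the value 2.
  First, a power series \<open>P\<close>, in fact a polynomial, with \<open>P(0) = 1\<close> may vanish at 1 to any order
  although its absolute coefficient sum is as close to 2 as desired (\<open>exists_wiener_zero\<close>).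
  Second, once \<open>P\<close> has a zero of order four at 1, the factor \<open>(1 - z)\<^sup>4\<close> tames the singularity of the exponential, and the
  coefficients of \<open>(1 - z)\<^sup>4 (exp (- c z / (1 - z)) - 1)\<close> have absolute sum \<open>O(c)\<close>
  (\<open>wiener_le_singular_inner\<close>). One chooses \<open>P\<close> first and then \<open>c\<close> small.
\<close>

section \<open>Power series with absolutely summable coefficients\<close>

text \<open>The function \<open>f\<close> belongs, on the open unit disc, to the Wiener algebra of absolutely summable
  power series, and \<open>B\<close> bounds its norm there. Stating a bound instead of taking the norm of \<open>f\<close>
  makes every estimate below a consequence of a few closure rules.\<close>

definition wiener_le :: "(complex \<Rightarrow> complex) \<Rightarrow> real \<Rightarrow> bool" where
  "wiener_le f B \<longleftrightarrow> (\<exists>a. summable (\<lambda>n. norm (a n)) \<and> (\<Sum>n. norm (a n)) \<le> B \<and>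
     (\<forall>z\<in>ball 0 1. (\<lambda>n. a n * z ^ n) sums f z))"

lemma wiener_leI:
  assumes "summable (\<lambda>n. norm (a n))" "(\<Sum>n. norm (a n)) \<le> B"
    "\<And>z. cmod z < 1 \<Longrightarrow> (\<lambda>n. a n * z ^ n) sums f z"
  shows "wiener_le f B"
  using assms unfolding wiener_le_def by auto

lemma wiener_le_mono: "wiener_le f B \<Longrightarrow> B \<le> B' \<Longrightarrow> wiener_le f B'"
  unfolding wiener_le_def by (meson order_trans)

lemma wiener_le_monomial: "wiener_le (\<lambda>z. c * z ^ m) (norm c)"
proof (rule wiener_leI)
  let ?a = "\<lambda>n. if n = m then c else 0"
  have s: "(\<lambda>n. norm (?a n)) sums norm c"
    using sums_single[of m "\<lambda>_. norm c"] by (simp add: if_distrib[of norm] cong: if_cong)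
  show "summable (\<lambda>n. norm (?a n))" "(\<Sum>n. norm (?a n)) \<le> norm c"
    using s by (auto simp: sums_iff)
  show "(\<lambda>n. ?a n * z ^ n) sums (c * z ^ m)" for z
    using sums_single[of m "\<lambda>n. c * z ^ n"] by (simp add: if_distrib[of "\<lambda>x. x * _"] cong: if_cong)
qed

lemma wiener_le_add:
  assumes "wiener_le f B" "wiener_le g C"
  shows "wiener_le (\<lambda>z. f z + g z) (B + C)"
proof -
  obtain a where a: "summable (\<lambda>n. norm (a n))" "(\<Sum>n. norm (a n)) \<le> B"
    "\<And>z. cmod z < 1 \<Longrightarrow> (\<lambda>n. a n * z ^ n) sums f z" using assms(1) unfolding wiener_le_def by auto
  obtain b where b: "summable (\<lambda>n. norm (b n))" "(\<Sum>n. norm (b n)) \<le> C"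
    "\<And>z. cmod z < 1 \<Longrightarrow> (\<lambda>n. b n * z ^ n) sums g z" using assms(2) unfolding wiener_le_def by auto
  have s: "summable (\<lambda>n. norm (a n) + norm (b n))" using a b by (intro summable_add)
  have s': "summable (\<lambda>n. norm (a n + b n))"
    by (rule summable_comparison_test'[OF s, of 0]) (simp add: norm_triangle_ineq)
  have "(\<Sum>n. norm (a n + b n)) \<le> (\<Sum>n. norm (a n) + norm (b n))"
    by (intro suminf_le s s') (simp add: norm_triangle_ineq)
  also have "\<dots> \<le> B + C" using a b by (simp add: suminf_add[symmetric])
  finally show ?thesis
    using s' a(3) b(3) by (intro wiener_leI[of "\<lambda>n. a n + b n"]) (auto simp: ring_distribs intro: sums_add)
qed

text \<open>The coefficient norm is submultiplicative: the coefficients of a product are the Cauchy product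
  of the coefficients, and the same identity for their absolute values gives the bound.\<close>

lemma wiener_le_mult:
  assumes "wiener_le f B" "wiener_le g C"
  shows "wiener_le (\<lambda>z. f z * g z) (B * C)"
proof -
  obtain a where a: "summable (\<lambda>n. norm (a n))" "(\<Sum>n. norm (a n)) \<le> B"
    "\<And>z. cmod z < 1 \<Longrightarrow> (\<lambda>n. a n * z ^ n) sums f z" using assms(1) unfolding wiener_le_def by auto
  obtain b where b: "summable (\<lambda>n. norm (b n))" "(\<Sum>n. norm (b n)) \<le> C"
    "\<And>z. cmod z < 1 \<Longrightarrow> (\<lambda>n. b n * z ^ n) sums g z" using assms(2) unfolding wiener_le_def by auto
  define p where "p = (\<lambda>k. \<Sum>i\<le>k. a i * b (k - i))"
  have s: "(\<lambda>k. \<Sum>i\<le>k. norm (a i) * norm (b (k - i))) sums ((\<Sum>n. norm (a n)) * (\<Sum>n. norm (b n)))"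
    using a b by (intro Cauchy_product_sums) auto
  have le: "norm (p k) \<le> (\<Sum>i\<le>k. norm (a i) * norm (b (k - i)))" for k
    unfolding p_def by (rule order_trans[OF norm_sum]) (simp add: norm_mult)
  have sp: "summable (\<lambda>k. norm (p k))"
    using s le by (intro summable_comparison_test'[of _ 0 "\<lambda>k. norm (p k)"]) (auto simp: sums_iff)
  have B0: "0 \<le> B" using suminf_nonneg[OF a(1)] a(2) by force
  have "(\<Sum>k. norm (p k)) \<le> (\<Sum>n. norm (a n)) * (\<Sum>n. norm (b n))"
    using suminf_le[OF le sp] s by (auto simp: sums_iff)
  also have "\<dots> \<le> B * C"
    using a b B0 by (intro mult_mono) (auto intro: suminf_nonneg)
  finally have bound: "(\<Sum>k. norm (p k)) \<le> B * C" .
  have "(\<lambda>k. p k * z ^ k) sums (f z * g z)" if z: "cmod z < 1" for z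
  proof -
    have abs: "summable (\<lambda>n. norm (x n * z ^ n))" if "summable (\<lambda>n. norm (x n))" for x :: "nat \<Rightarrow> complex"
      using z by (intro summable_comparison_test'[OF that, of 0])
        (auto simp: norm_mult norm_power intro!: mult_left_le power_le_one)
    have "(\<lambda>k. \<Sum>i\<le>k. (a i * z ^ i) * (b (k - i) * z ^ (k - i))) sums (f z * g z)"
      using Cauchy_product_sums[OF abs[OF a(1)] abs[OF b(1)]] a(3)[OF z] b(3)[OF z]
      by (simp add: sums_iff)
    also have "(\<lambda>k. \<Sum>i\<le>k. (a i * z ^ i) * (b (k - i) * z ^ (k - i))) = (\<lambda>k. p k * z ^ k)"
    proof
      fix k
      have t: "(a i * z ^ i) * (b (k - i) * z ^ (k - i)) = (a i * b (k - i)) * z ^ k" if "i \<le> k" for i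
        using power_add[of z i "k - i"] that by simp
      show "(\<Sum>i\<le>k. (a i * z ^ i) * (b (k - i) * z ^ (k - i))) = p k * z ^ k"
        unfolding p_def sum_distrib_right by (rule sum.cong[OF refl]) (simp only: t atMost_iff)
    qed
    finally show ?thesis .
  qed
  with sp bound show ?thesis by (intro wiener_leI)
qed

lemma wiener_le_sum:
  assumes "finite I" "\<And>i. i \<in> I \<Longrightarrow> wiener_le (f i) (B i)"
  shows "wiener_le (\<lambda>z. \<Sum>i\<in>I. f i z) (\<Sum>i\<in>I. B i)"
  using assms
proof (induction I)
  case empty
  show ?case using wiener_le_monomial[of 0 0] by simp
next
  case (insert i I)
  then show ?case by (simp add: wiener_le_add)
qed

lemma wiener_le_one_minus: "wiener_le (\<lambda>z. 1 - z) 2"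
  using wiener_le_add[OF wiener_le_monomial[of 1 0] wiener_le_monomial[of "- 1" 1]] by simp

lemma wiener_le_power:
  assumes "wiener_le f B"
  shows "wiener_le (\<lambda>z. f z ^ m) (B ^ m)"
proof (induction m)
  case 0
  show ?case using wiener_le_monomial[of 1 0] by simp
next
  case (Suc m)
  then show ?case using wiener_le_mult[OF assms] by simp
qed

lemma wiener_le_norm:
  assumes "wiener_le f B" "cmod z < 1"
  shows "cmod (f z) \<le> B"
proof -
  obtain a where a: "summable (\<lambda>n. norm (a n))" "(\<Sum>n. norm (a n)) \<le> B"
    "\<And>z. cmod z < 1 \<Longrightarrow> (\<lambda>n. a n * z ^ n) sums f z" using assms(1) unfolding wiener_le_def by auto
  have le: "norm (a n * z ^ n) \<le> norm (a n)" for n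
    using assms(2) by (auto simp: norm_mult norm_power intro!: mult_left_le power_le_one)
  have s: "summable (\<lambda>n. norm (a n * z ^ n))"
    using le by (intro summable_comparison_test'[OF a(1), of 0]) auto
  have "cmod (f z) = norm (\<Sum>n. a n * z ^ n)" using a(3)[OF assms(2)] by (simp add: sums_iff)
  also have "\<dots> \<le> (\<Sum>n. norm (a n * z ^ n))" by (rule summable_norm[OF s])
  also have "\<dots> \<le> (\<Sum>n. norm (a n))" by (rule suminf_le[OF le s a(1)])
  finally show ?thesis using a(2) by simp
qed

lemma wiener_le_nonneg: "wiener_le f B \<Longrightarrow> 0 \<le> B"
  using wiener_le_norm[of f B 0] norm_ge_zero[of "f 0"] by (simp del: norm_ge_zero)

text \<open>Cauchy's estimate for \<open>f''\<close> on circles of radius \<open>r < 1\<close>, with \<open>r\<close> tending to 1, gives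
  \<open>(n + 1) (n + 2) \<bar>a\<^sub>n\<^sub>+\<^sub>2\<bar> \<le> K\<close>, and \<open>1 / ((n + 1) (n + 2))\<close> telescopes to the sum 1.
  Two bounded derivatives are thus a convenient certificate of absolute summability.\<close>

lemma wiener_le_second_derivative:
  assumes f1: "\<And>z. cmod z < 1 \<Longrightarrow> (f has_field_derivative f' z) (at z)"
    and f2: "\<And>z. cmod z < 1 \<Longrightarrow> (f' has_field_derivative f'' z) (at z)"
    and bd: "\<And>z. cmod z < 1 \<Longrightarrow> cmod (f'' z) \<le> K"
  shows "wiener_le f (cmod (f 0) + cmod (f' 0) + K)"
proof -
  define a where "a = (\<lambda>n. (deriv ^^ n) f 0 / fact n)"
  have holf: "f holomorphic_on ball 0 1"
    by (simp add: holomorphic_on_open) (meson f1 mem_ball_0)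
  have d1: "deriv f z = f' z" if "cmod z < 1" for z
    using f1[OF that] by (rule DERIV_imp_deriv)
  have d2: "deriv (deriv f) z = f'' z" if z: "cmod z < 1" for z
  proof -
    have "eventually (\<lambda>w. w \<in> ball 0 1) (nhds z)"
      using z by (intro eventually_nhds_in_open) auto
    then have "eventually (\<lambda>w. deriv f w = f' w) (nhds z)"
      by eventually_elim (simp add: d1)
    then have "deriv (deriv f) z = deriv f' z" by (intro deriv_cong_ev) auto
    also have "\<dots> = f'' z" using f2[OF z] by (rule DERIV_imp_deriv)
    finally show ?thesis .
  qed
  have hol2: "deriv (deriv f) holomorphic_on ball 0 1"
    by (intro holomorphic_deriv holf) auto
  have K: "0 \<le> K" using bd[of 0] norm_ge_zero[of "f'' 0"] by (simp del: norm_ge_zero)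
  have cauchy: "cmod ((deriv ^^ n) (deriv (deriv f)) 0) \<le> fact n * K" for n
  proof -
    have r: "cmod ((deriv ^^ n) (deriv (deriv f)) 0) * r ^ n \<le> fact n * K" if "0 < r" "r < 1" for r
    proof -
      have "cmod ((deriv ^^ n) (deriv (deriv f)) 0) \<le> fact n * K / r ^ n"
      proof (rule Cauchy_inequality)
        show "deriv (deriv f) holomorphic_on ball 0 r"
          by (rule holomorphic_on_subset[OF hol2]) (use that in auto)
        show "continuous_on (cball 0 r) (deriv (deriv f))"
          by (rule holomorphic_on_imp_continuous_on, rule holomorphic_on_subset[OF hol2]) (use that in auto)
        show "cmod (deriv (deriv f) x) \<le> K" if "norm (0 - x) = r" for x
          using that \<open>r < 1\<close> by (simp add: d2 bd)
      qed (use that in auto)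
      then show ?thesis using that by (simp add: field_simps)
    qed
    have lim: "((\<lambda>r. cmod ((deriv ^^ n) (deriv (deriv f)) 0) * r ^ n)
        \<longlongrightarrow> cmod ((deriv ^^ n) (deriv (deriv f)) 0) * 1 ^ n) (at_left 1)"
      by (intro tendsto_intros)
    have "eventually (\<lambda>r::real. r \<in> {0<..<1}) (at_left 1)"
      by (rule eventually_at_left_real) simp
    then have "eventually (\<lambda>r::real. cmod ((deriv ^^ n) (deriv (deriv f)) 0) * r ^ n \<le> fact n * K) (at_left 1)"
      by eventually_elim (use r in auto)
    from tendsto_upperbound[OF lim this] show ?thesis by simp
  qed
  have tail: "cmod (a (n + 2)) \<le> K * (1 / real (Suc n) - 1 / real (Suc (Suc n)))" for n
  proof -
    have "(deriv ^^ (n + 2)) f 0 = (deriv ^^ n) (deriv (deriv f)) 0"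
      by (simp add: funpow_swap1)
    then have "cmod (a (n + 2)) = cmod ((deriv ^^ n) (deriv (deriv f)) 0) / fact (n + 2)"
      by (simp only: a_def norm_divide norm_fact)
    also have "\<dots> \<le> fact n * K / fact (n + 2)"
      by (intro divide_right_mono cauchy) auto
    also have "\<dots> = K * (1 / real (Suc n) - 1 / real (Suc (Suc n)))"
      by (simp add: divide_simps)
    finally show ?thesis .
  qed
  have "(\<lambda>n. 1 / real (Suc n) - 1 / real (Suc (Suc n))) sums (1 / real (Suc 0) - 0)"
    by (rule telescope_sums') real_asymp
  then have ts: "(\<lambda>n. K * (1 / real (Suc n) - 1 / real (Suc (Suc n)))) sums K"
    using sums_mult[of _ "1::real" K] by simp
  have s2: "summable (\<lambda>n. cmod (a (n + 2)))"
    by (rule summable_comparison_test'[OF sums_summable[OF ts], of 0])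
      (simp only: real_norm_def abs_norm_cancel tail)
  then have s: "summable (\<lambda>n. cmod (a n))" by (subst (asm) summable_iff_shift)
  have a0: "a 0 = f 0" by (simp add: a_def)
  have a1: "a 1 = f' 0" by (simp add: a_def d1)
  have "(\<Sum>n. cmod (a (n + 2))) \<le> K"
    using suminf_le[OF tail s2 sums_summable[OF ts]] by (simp only: sums_unique[OF ts, symmetric])
  then have "(\<Sum>n. cmod (a n)) \<le> cmod (f 0) + cmod (f' 0) + K"
    using suminf_split_initial_segment[OF s, of 2] a0 a1 by (simp add: numeral_2_eq_2)
  moreover have "(\<lambda>n. a n * z ^ n) sums f z" if "cmod z < 1" for z
    using holomorphic_power_series[OF holf, of z] that by (simp add: a_def)
  ultimately show ?thesis using s by (intro wiener_leI)
qed

section \<open>Zeros of high order at small cost\<close>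

text \<open>Multiplying \<open>P = (1 - z)\<^bsup>k+1\<^esup> R\<close> by \<open>1 - (z + \<dots> + z\<^sup>N) / N\<close> raises the order of the zero at 1 by
  one and keeps the value at 0. The change \<open>P (z + \<dots> + z\<^sup>N) / N\<close> is a moving average of
  coefficients that already contain a difference, so it telescopes to
  \<open>(1 - z)\<^sup>k R (z - z\<^bsup>N+1\<^esup>) / N\<close>, whose norm is \<open>O(1 / N)\<close>. Hence each additional order costs
  arbitrarily little over the norm 2 of \<open>1 - z\<close>.\<close>

lemma exists_wiener_zero:
  assumes "0 < \<epsilon>"
  shows "\<exists>R B. wiener_le R B \<and> R 0 = 1 \<and> wiener_le (\<lambda>z. (1 - z) ^ Suc k * R z) (2 + \<epsilon>)"
  using assms
proof (induction k arbitrary: \<epsilon>)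
  case 0
  have "wiener_le (\<lambda>z. (1 - z) ^ Suc 0 * 1) (2 + \<epsilon>)"
    using wiener_le_one_minus 0 by (auto intro: wiener_le_mono)
  moreover have "wiener_le (\<lambda>_. 1) 1" using wiener_le_monomial[of 1 0] by simp
  ultimately show ?case by (intro exI[of _ "\<lambda>_. 1"] exI[of _ 1]) auto
next
  case (Suc k)
  obtain R B where R: "wiener_le R B" "R 0 = 1" "wiener_le (\<lambda>z. (1 - z) ^ Suc k * R z) (2 + \<epsilon> / 2)"
    using Suc.IH[of "\<epsilon> / 2"] Suc.prems by auto
  have pow: "wiener_le (\<lambda>z. z ^ m) 1" for m using wiener_le_monomial[of 1 m] by simp
  define D where "D = 2 ^ k * B"
  have D: "wiener_le (\<lambda>z. (1 - z) ^ k * R z) D"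
    unfolding D_def by (intro wiener_le_mult wiener_le_power wiener_le_one_minus R)
  obtain N :: nat where N: "4 * D / \<epsilon> < real N" using reals_Archimedean2 by blast
  have "0 \<le> 4 * D / \<epsilon>" using wiener_le_nonneg[OF D] Suc.prems by simp
  with N have N0: "0 < real N" by linarith
  have DN: "2 * D / real N \<le> \<epsilon> / 2"
    using N N0 Suc.prems by (simp add: field_simps)
  \<comment> \<open>\<open>T\<close> is the cofactor in \<open>1 - (z + \<dots> + z\<^sup>N) / N = (1 - z) T(z)\<close>.\<close>
  define T where "T = (\<lambda>z::complex. (1 / of_nat N) * (\<Sum>j=1..N. \<Sum>i<j. z ^ i))"
  have T: "wiener_le T (norm (1 / of_nat N :: complex) * (\<Sum>j=1..N. \<Sum>i<j. 1))"
    unfolding T_def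
    by (intro wiener_le_mult wiener_le_sum pow) (use wiener_le_monomial[of "1 / of_nat N" 0] in auto)
  have T0: "T 0 = 1"
  proof -
    have "(\<Sum>i<j. (0::complex) ^ i) = 1" if "j \<in> {1..N}" for j
      using that by (cases j) (auto simp: sum.lessThan_Suc_shift simp del: sum.lessThan_Suc)
    then have "(\<Sum>j=1..N. \<Sum>i<j. (0::complex) ^ i) = of_nat N" by simp
    then show ?thesis using N0 by (simp add: T_def)
  qed
  have TS: "(1 - z) ^ Suc k * R z + (1 / of_nat N) * ((- 1 * z ^ 1 + 1 * z ^ Suc N) * ((1 - z) ^ k * R z))
      = (1 - z) ^ Suc (Suc k) * (R z * T z)" for z
  proof -
    have g: "(1 - z) * (\<Sum>i<j. z ^ i) = 1 - z ^ j" for j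
      by (simp add: one_diff_power_eq)
    have "(1 - z) * (\<Sum>j=1..N. \<Sum>i<j. z ^ i) = (\<Sum>j=1..N. 1 - z ^ j)"
      by (subst sum_distrib_left) (simp only: g)
    also have "\<dots> = of_nat N - (\<Sum>j=1..N. z ^ j)" by (simp add: sum_subtractf)
    also have "(\<Sum>j=1..N. z ^ j) = z * (\<Sum>i<N. z ^ i)"
      by (simp add: sum_distrib_left sum.atLeast1_atMost_eq)
    finally have S: "(1 - z) * (\<Sum>j=1..N. \<Sum>i<j. z ^ i) = of_nat N - z * (\<Sum>i<N. z ^ i)" .
    have "(1 - z) * (of_nat N - z * (\<Sum>i<N. z ^ i)) = (1 - z) * of_nat N - z * ((1 - z) * (\<Sum>i<N. z ^ i))"
      by (simp only: right_diff_distrib mult_ac)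
    also have "\<dots> = (1 - z) * of_nat N - z * (1 - z ^ N)" by (simp only: g)
    finally have *: "(1 - z) * ((1 - z) * (\<Sum>j=1..N. \<Sum>i<j. z ^ i)) = (1 - z) * of_nat N - z * (1 - z ^ N)"
      by (simp only: S)
    have "(1 - z) ^ Suc (Suc k) * (R z * T z)
       = (1 - z) ^ k * R z * (1 / of_nat N) * ((1 - z) * ((1 - z) * (\<Sum>j=1..N. \<Sum>i<j. z ^ i)))"
      by (simp add: T_def mult_ac)
    also have "\<dots> = (1 - z) ^ k * R z * (1 / of_nat N) * ((1 - z) * of_nat N - z * (1 - z ^ N))"
      by (simp only: *)
    finally show ?thesis using N0 by (simp add: field_simps)
  qed
  have "wiener_le (\<lambda>z. (1 - z) ^ Suc k * R z + (1 / of_nat N) * ((- 1 * z ^ 1 + 1 * z ^ Suc N) * ((1 - z) ^ k * R z)))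
     ((2 + \<epsilon> / 2) + norm (1 / of_nat N :: complex) * ((norm (- 1 :: complex) + norm (1::complex)) * D))"
    by (intro wiener_le_add R wiener_le_mult wiener_le_monomial D)
      (use wiener_le_monomial[of "1 / of_nat N" 0] in auto)
  then have "wiener_le (\<lambda>z. (1 - z) ^ Suc (Suc k) * (R z * T z)) (2 + \<epsilon>)"
    unfolding TS by (rule wiener_le_mono) (use DN in \<open>simp add: norm_divide\<close>)
  moreover have "R 0 * T 0 = 1" using R T0 by simp
  ultimately show ?case using wiener_le_mult[OF R(1) T] by blast
qed

section \<open>The exponential factor\<close>

text \<open>The map \<open>z \<mapsto> 1 / (1 - z)\<close> takes the unit disc to the half plane \<open>Re > 1/2\<close>.\<close>

lemma Re_inverse_one_minus:
  assumes "cmod z < 1"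
  shows "1 / 2 < Re (1 / (1 - z))"
proof -
  have n: "(cmod (1 - z))\<^sup>2 = (1 - Re z)\<^sup>2 + (Im z)\<^sup>2" by (simp add: cmod_power2)
  have "(Re z)\<^sup>2 + (Im z)\<^sup>2 < 1" using assms
    by (metis abs_norm_cancel abs_square_less_1 cmod_power2)
  then have "(cmod (1 - z))\<^sup>2 < 2 * (1 - Re z)" unfolding n by (simp add: power2_eq_square algebra_simps)
  moreover have "0 < (cmod (1 - z))\<^sup>2" using assms by auto
  ultimately have "1 / 2 < (1 - Re z) / (cmod (1 - z))\<^sup>2" by (simp add: field_simps)
  also have "\<dots> = Re (1 / (1 - z))" by (simp add: Re_divide n)
  finally show ?thesis .
qed

text \<open>Mean value estimate on the half plane \<open>Re \<le> 1\<close>, where \<open>\<bar>exp\<bar> \<le> e \<le> 3\<close>. It is needed for \<open>v\<close> of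
  large modulus, where the power series of the exponential gives nothing uniform.\<close>

lemma norm_exp_minus_one_le:
  assumes "Re v \<le> 1"
  shows "cmod (exp v - 1) \<le> 3 * cmod v"
proof -
  have "cmod (exp v - exp 0) \<le> 3 * cmod (v - 0)"
  proof (rule field_differentiable_bound)
    show "convex {w. Re w \<le> 1}" by (rule convex_halfspace_Re_le)
    show "(exp has_field_derivative exp w) (at w within {w. Re w \<le> 1})" for w :: complex
      by (rule DERIV_subset[OF DERIV_exp]) simp
    show "cmod (exp w) \<le> 3" if "w \<in> {w. Re w \<le> 1}" for w
      using that exp_le order_trans[of "exp (Re w)" "exp 1" 3] by simp
  qed (use assms in auto)
  then show ?thesis by simp
qed

text \<open>Writing \<open>w = 1 - z\<close> and \<open>E = exp (c - c / w) = exp (- c z / (1 - z))\<close>, each derivative of \<open>E\<close> costs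
  a factor \<open>c / w\<^sup>2\<close>; the prefactor \<open>w\<^sup>4\<close> pays for two of them. The second derivative is
  \<open>12 w\<^sup>2 (E - 1) + 6 c w E + c\<^sup>2 E\<close>, where \<open>E\<close> is bounded on the disc and
  \<open>\<bar>w (E - 1)\<bar> = O(c)\<close>, so it is \<open>O(c)\<close> throughout.\<close>

lemma wiener_le_singular_inner:
  assumes c: "0 < c" "c \<le> 1"
  shows "wiener_le (\<lambda>z. (1 - z) ^ 4 * (exp (of_real c - of_real c / (1 - z)) - 1)) (112 * c)"
proof -
  define E where "E = (\<lambda>z::complex. exp (of_real c - of_real c / (1 - z)))"
  define F where "F = (\<lambda>z. (1 - z) ^ 4 * (E z - 1))"
  define F1 where "F1 = (\<lambda>z. - 4 * (1 - z) ^ 3 * (E z - 1) - of_real c * (1 - z) ^ 2 * E z)"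
  define F2 where "F2 = (\<lambda>z. 12 * (1 - z) ^ 2 * (E z - 1) + 6 * of_real c * (1 - z) * E z + of_real c ^ 2 * E z)"
  have "wiener_le F (cmod (F 0) + cmod (F1 0) + 111 * c)"
  proof (rule wiener_le_second_derivative)
    fix z :: complex assume z: "cmod z < 1"
    then have nz: "1 - z \<noteq> 0" by auto
    have E': "(E has_field_derivative (- of_real c / (1 - z) ^ 2 * E z)) (at z)"
      unfolding E_def using nz
      by (auto intro!: derivative_eq_intros simp: power2_eq_square)
    have E4: "- of_real c / (1 - z) ^ 2 * E z * (1 - z) ^ 4 = - of_real c * (1 - z) ^ 2 * E z"
      and E3: "- of_real c / (1 - z) ^ 2 * E z * (1 - z) ^ 3 = - of_real c * (1 - z) * E z"
      and E2: "- of_real c / (1 - z) ^ 2 * E z * (1 - z) ^ 2 = - of_real c * E z"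
      using nz by (simp_all add: power4_eq_xxxx power3_eq_cube power2_eq_square)
    have pw: "((\<lambda>z. (1 - z) ^ m) has_field_derivative - (of_nat m * (1 - z) ^ (m - 1))) (at z)" for m
      by (auto intro!: derivative_eq_intros)
    have "(F has_field_derivative
        - (of_nat 4 * (1 - z) ^ (4 - 1)) * (E z - 1) + (- of_real c / (1 - z) ^ 2 * E z - 0) * (1 - z) ^ 4) (at z)"
      unfolding F_def by (intro DERIV_mult pw DERIV_diff E' DERIV_const)
    also have "- (of_nat 4 * (1 - z) ^ (4 - 1)) * (E z - 1) + (- of_real c / (1 - z) ^ 2 * E z - 0) * (1 - z) ^ 4 = F1 z"
      using E4 by (simp add: F1_def)
    finally show "(F has_field_derivative F1 z) (at z)" .
    have "(F1 has_field_derivative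
        (- 4 * - (of_nat 3 * (1 - z) ^ (3 - 1))) * (E z - 1)
          + (- of_real c / (1 - z) ^ 2 * E z - 0) * (- 4 * (1 - z) ^ 3)
        - ((of_real c * - (of_nat 2 * (1 - z) ^ (2 - 1))) * E z
          + (- of_real c / (1 - z) ^ 2 * E z) * (of_real c * (1 - z) ^ 2))) (at z)"
      unfolding F1_def by (intro DERIV_mult DERIV_cmult pw DERIV_diff E' DERIV_const)
    also have "(- 4 * - (of_nat 3 * (1 - z) ^ (3 - 1))) * (E z - 1)
          + (- of_real c / (1 - z) ^ 2 * E z - 0) * (- 4 * (1 - z) ^ 3)
        - ((of_real c * - (of_nat 2 * (1 - z) ^ (2 - 1))) * E z
          + (- of_real c / (1 - z) ^ 2 * E z) * (of_real c * (1 - z) ^ 2))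
      = 12 * (1 - z) ^ 2 * (E z - 1) + 2 * of_real c * (1 - z) * E z
        - 4 * (- of_real c / (1 - z) ^ 2 * E z * (1 - z) ^ 3)
        - of_real c * (- of_real c / (1 - z) ^ 2 * E z * (1 - z) ^ 2)"
      by (simp del: times_divide_eq_left) (simp add: algebra_simps)
    also have "\<dots> = F2 z" unfolding E2 E3 F2_def by (simp add: power2_eq_square)
    finally show "(F1 has_field_derivative F2 z) (at z)" .
    define v where "v = of_real c - of_real c / (1 - z)"
    have Rev: "Re v = c * (1 - Re (1 / (1 - z)))"
      unfolding v_def by (simp add: Re_divide algebra_simps)
    have "Re v \<le> c * 1" unfolding Rev using Re_inverse_one_minus[OF z] c
      by (intro mult_left_mono) auto
    then have v1: "Re v \<le> 1" using c by simp
    have w2: "cmod (1 - z) \<le> 2" using norm_triangle_ineq4[of 1 z] z by simp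
    have Ez: "cmod (E z) \<le> 3"
      using v1 exp_le order_trans[of "exp (Re v)" "exp 1" 3] by (simp add: E_def v_def)
    have "(1 - z) * v = - of_real c * z" using nz by (simp add: v_def field_simps)
    then have wv: "cmod (1 - z) * cmod v \<le> c"
      using z c by (simp add: norm_mult[symmetric]) (simp add: norm_mult)
    have "cmod ((1 - z) ^ 2 * (E z - 1)) \<le> cmod (1 - z) ^ 2 * (3 * cmod v)"
      using norm_exp_minus_one_le[OF v1]
      by (simp add: norm_mult norm_power E_def v_def mult_left_mono)
    also have "\<dots> = 3 * cmod (1 - z) * (cmod (1 - z) * cmod v)" by (simp add: power2_eq_square)
    also have "\<dots> \<le> 3 * 2 * c" using w2 wv c by (intro mult_mono) auto
    finally have b1: "cmod ((1 - z) ^ 2 * (E z - 1)) \<le> 6 * c" by simp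
    have "cmod ((1 - z) * E z) \<le> 2 * 3" unfolding norm_mult using w2 Ez by (intro mult_mono) auto
    then have b2: "c * cmod ((1 - z) * E z) \<le> c * 6" using c by (intro mult_left_mono) auto
    have b3: "c ^ 2 * cmod (E z) \<le> c * 3"
      using c Ez by (intro mult_mono) (auto simp: power2_eq_square mult_left_le)
    have "cmod (F2 z) \<le> cmod (12 * ((1 - z) ^ 2 * (E z - 1))) + cmod (6 * of_real c * ((1 - z) * E z)) + cmod (of_real c ^ 2 * E z)"
      unfolding F2_def
      by (intro norm_triangle_le add_mono) (auto simp: mult.assoc norm_triangle_ineq)
    also have "\<dots> = 12 * cmod ((1 - z) ^ 2 * (E z - 1)) + 6 * (c * cmod ((1 - z) * E z)) + c ^ 2 * cmod (E z)"
      using c by (simp add: norm_mult norm_power)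
    also have "\<dots> \<le> 12 * (6 * c) + 6 * (c * 6) + c * 3"
      by (intro add_mono mult_left_mono b1 b2 b3) auto
    finally show "cmod (F2 z) \<le> 111 * c" by simp
  qed
  moreover have "F 0 = 0" "cmod (F1 0) = c" using c by (auto simp: F_def F1_def E_def)
  ultimately show ?thesis by (simp add: F_def E_def)
qed

section \<open>The noise-shaping filter\<close>

text \<open>The term \<open>\<delta>\<close> is spent in equal parts on making the zero of order four and on inserting the
  exponential. One factor \<open>1 - z\<close> is kept in the bound on \<open>G\<close>, to compensate later for the growth
  \<open>M / \<bar>1 - z\<bar>\<close> of a power series with bounded coefficients.\<close>

lemma exists_flat_filter:
  assumes "0 < \<delta>"
  shows "\<exists>c>0. \<exists>K\<ge>0. \<exists>G. G 0 = 1 \<and> wiener_le G (2 + \<delta>) \<and>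
    (\<forall>z. cmod z < 1 \<longrightarrow> cmod (G z) \<le> K * cmod (1 - z) * exp (- c * Re (1 / (1 - z))))"
proof -
  obtain R B where R: "wiener_le R B" "R 0 = 1" "wiener_le (\<lambda>z. (1 - z) ^ Suc 3 * R z) (2 + \<delta> / 2)"
    using exists_wiener_zero[of "\<delta> / 2" 3] assms by auto
  have B: "0 \<le> B" using R(1) by (rule wiener_le_nonneg)
  define c where "c = min 1 (\<delta> / (224 * (B + 1)))"
  have c: "0 < c" "c \<le> 1" using B assms by (auto simp: c_def)
  have "c * (224 * (B + 1)) \<le> \<delta>" using B by (simp add: c_def min_le_iff_disj pos_le_divide_eq[symmetric])
  then have cB: "B * (112 * c) \<le> \<delta> / 2" using c by (simp add: algebra_simps)
  define E where "E = (\<lambda>z::complex. exp (of_real c - of_real c / (1 - z)))"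
  define G where "G = (\<lambda>z. (1 - z) ^ Suc 3 * R z + R z * ((1 - z) ^ 4 * (E z - 1)))"
  have "wiener_le G ((2 + \<delta> / 2) + B * (112 * c))"
    unfolding G_def E_def by (intro wiener_le_add wiener_le_mult R wiener_le_singular_inner c)
  then have "wiener_le G (2 + \<delta>)" by (rule wiener_le_mono) (use cB in simp)
  moreover have "G 0 = 1" by (simp add: G_def E_def R)
  moreover have "cmod (G z) \<le> (8 * B * exp c) * cmod (1 - z) * exp (- c * Re (1 / (1 - z)))"
    if z: "cmod z < 1" for z
  proof -
    have Re_c: "Re (of_real c / (1 - z)) = c * Re (1 / (1 - z))" by (simp add: Re_divide)
    have "G z = (1 - z) ^ 3 * R z * (1 - z) * E z" by (simp add: G_def power_numeral_reduce algebra_simps)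
    then have "cmod (G z) = cmod (1 - z) ^ 3 * cmod (R z) * cmod (1 - z) * cmod (E z)"
      by (simp add: norm_mult norm_power)
    also have "cmod (E z) = exp c * exp (- c * Re (1 / (1 - z)))"
      by (simp add: E_def Re_c exp_add[symmetric])
    also have "cmod (1 - z) ^ 3 * cmod (R z) * cmod (1 - z) * (exp c * exp (- c * Re (1 / (1 - z))))
      \<le> 2 ^ 3 * B * cmod (1 - z) * (exp c * exp (- c * Re (1 / (1 - z))))"
      using norm_triangle_ineq4[of 1 z] z B
      by (intro mult_right_mono mult_mono power_mono wiener_le_norm[OF R(1)]) auto
    finally show ?thesis by (simp add: mult_ac)
  qed
  ultimately show ?thesis using c B
    by (intro exI[of _ c] conjI exI[of _ "8 * B * exp c"] exI[of _ G]) auto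
qed

text \<open>Taking real parts of the coefficients replaces \<open>G\<close> by its average with the conjugate function
  \<open>z \<mapsto> cnj (G (cnj z))\<close>. Every bound on \<open>G\<close> that is symmetric under conjugation is inherited, so a
  filter with real coefficients can be had without tracking reality through its construction.\<close>

lemma wiener_le_real_part:
  assumes "wiener_le G B"
  obtains g :: "nat \<Rightarrow> real" where "summable (\<lambda>n. \<bar>g n\<bar>)" "(\<Sum>n. \<bar>g n\<bar>) \<le> B"
    "\<And>z. cmod z < 1 \<Longrightarrow> (\<lambda>n. of_real (g n) * z ^ n) sums ((G z + cnj (G (cnj z))) / 2)"
proof -
  obtain a where a: "summable (\<lambda>n. norm (a n))" "(\<Sum>n. norm (a n)) \<le> B"
    "\<And>z. cmod z < 1 \<Longrightarrow> (\<lambda>n. a n * z ^ n) sums G z" using assms unfolding wiener_le_def by auto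
  have le: "\<bar>Re (a n)\<bar> \<le> norm (a n)" for n by (rule abs_Re_le_cmod)
  have s: "summable (\<lambda>n. \<bar>Re (a n)\<bar>)"
    using le by (intro summable_comparison_test'[OF a(1), of 0]) auto
  moreover have "(\<Sum>n. \<bar>Re (a n)\<bar>) \<le> B" using suminf_le[OF le s a(1)] a(2) by simp
  moreover have "(\<lambda>n. of_real (Re (a n)) * z ^ n) sums ((G z + cnj (G (cnj z))) / 2)" if z: "cmod z < 1" for z
  proof -
    have "(\<lambda>n. cnj (a n * cnj z ^ n)) sums cnj (G (cnj z))"
      using z a(3)[of "cnj z"] by (simp only: sums_cnj) simp
    then have "(\<lambda>n. (a n * z ^ n + cnj (a n * cnj z ^ n)) / 2) sums ((G z + cnj (G (cnj z))) / 2)"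
      using a(3)[OF z] by (intro sums_divide sums_add)
    also have "(\<lambda>n. (a n * z ^ n + cnj (a n * cnj z ^ n)) / 2) = (\<lambda>n. of_real (Re (a n)) * z ^ n)"
      by (simp add: ring_distribs[symmetric] complex_add_cnj)
    finally show ?thesis .
  qed
  ultimately show ?thesis using that[of "\<lambda>n. Re (a n)"] by blast
qed

section \<open>One-bit quantization\<close>

text \<open>The subtracted value, 1 or -1, is the output bit of the greedy quantizer applied to \<open>v\<close>.\<close>

fun quantizer_state :: "(nat \<Rightarrow> real) \<Rightarrow> (nat \<Rightarrow> real) \<Rightarrow> nat \<Rightarrow> real" where
  "quantizer_state g a n =
     (let v = a n - (\<Sum>k<n. quantizer_state g a k * g (n - k)) in if v \<ge> 0 then v - 1 else v + 1)"

declare quantizer_state.simps [simp del]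

text \<open>Stability of the greedy choice: if all earlier states lie in \<open>[-1, 1]\<close>, then \<open>v\<^sub>n\<close> lies in
  \<open>[-2, 2]\<close> because \<open>\<mu> + (2 - \<mu>) = 2\<close>, and subtracting its sign brings it back to \<open>[-1, 1]\<close>.\<close>

lemma exists_one_bit_quantization:
  fixes g a :: "nat \<Rightarrow> real"
  assumes g0: "g 0 = 1" and g: "\<And>n. (\<Sum>k<n. \<bar>g (n - k)\<bar>) \<le> 2 - \<mu>" and a: "\<And>n. \<bar>a n\<bar> \<le> \<mu>"
  obtains q u where "\<And>n. q n \<in> {-1, 1 :: real}" "\<And>n. \<bar>u n\<bar> \<le> (1 :: real)"
    "\<And>n. a n - q n = (\<Sum>k\<le>n. u k * g (n - k))"
proof -
  define u where "u = quantizer_state g a"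
  define v where "v = (\<lambda>n. a n - (\<Sum>k<n. u k * g (n - k)))"
  define q where "q = (\<lambda>n. if v n \<ge> 0 then 1 else - 1 :: real)"
  have u: "u n = v n - q n" for n
    unfolding u_def v_def q_def by (subst quantizer_state.simps) (simp add: Let_def)
  have "\<bar>u n\<bar> \<le> 1" for n
  proof (induction n rule: less_induct)
    case (less n)
    have "\<bar>\<Sum>k<n. u k * g (n - k)\<bar> \<le> (\<Sum>k<n. \<bar>u k * g (n - k)\<bar>)" by (rule sum_abs)
    also have "\<dots> \<le> (\<Sum>k<n. \<bar>g (n - k)\<bar>)"
      using less by (intro sum_mono) (simp add: abs_mult mult_left_le_one_le)
    also have "\<dots> \<le> 2 - \<mu>" by (rule g)
    finally have "\<bar>v n\<bar> \<le> 2" using a[of n] by (simp add: v_def)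
    then show ?case by (auto simp: u q_def)
  qed
  moreover have "a n - q n = (\<Sum>k\<le>n. u k * g (n - k))" for n
    using u[of n] by (simp add: lessThan_Suc_atMost[symmetric] g0 v_def)
  moreover have "q n \<in> {-1, 1}" for n by (simp add: q_def)
  ultimately show ?thesis using that[of q u] by blast
qed

section \<open>Exponentially accurate approximation on the Stolz region\<close>

text \<open>The only place where the shape of the Stolz region enters the decay rate:
  \<open>Re (1 / (1 - z)) = (1 - Re z) / \<bar>1 - z\<bar>\<^sup>2\<close> and \<open>1 - Re z \<ge> 1 - \<bar>z\<bar> \<ge> \<bar>1 - z\<bar> / M\<close>.\<close>

lemma Re_inverse_one_minus_stolz:
  assumes "z \<in> stolz_region M - {1}" "1 \<le> M"
  shows "1 / (M * cmod (1 - z)) \<le> Re (1 / (1 - z))"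
proof -
  have p: "0 < cmod (1 - z)" using assms by simp
  have "cmod (1 - z) \<le> M * (1 - cmod z)" using assms by (simp add: stolz_region_def)
  also have "\<dots> \<le> M * (1 - Re z)" using assms complex_Re_le_cmod[of z] by (intro mult_left_mono) auto
  finally have "1 / (M * cmod (1 - z)) \<le> (1 - Re z) / (cmod (1 - z))\<^sup>2"
    using p assms(2) by (simp add: field_simps power2_eq_square)
  also have "\<dots> = Re (1 / (1 - z))" by (simp add: Re_divide cmod_power2)
  finally show ?thesis .
qed

theorem theorem1:
  fixes \<mu> M :: real
  assumes "0 \<le> \<mu>" and "\<mu> < 1" and "1 \<le> M"
  shows "\<exists>C1 > 0. \<exists>C2 > 0. \<forall>a :: nat \<Rightarrow> real. (\<forall>n. a n \<in> {-\<mu>..\<mu>}) \<longrightarrow>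
    (\<exists>q :: nat \<Rightarrow> real. (\<forall>n. q n \<in> {-1, 1}) \<and>
      (\<forall>z \<in> stolz_region M - {1}.
        cmod (real_power_series a z - real_power_series q z)
          < C1 * exp (- C2 / cmod (1 - z))))"
proof -
  obtain c K G where c: "0 < c" and K: "0 \<le> K" and G0: "G 0 = 1" and wG: "wiener_le G (2 + (1 - \<mu>))"
    and G: "\<And>z. cmod z < 1 \<Longrightarrow> cmod (G z) \<le> K * cmod (1 - z) * exp (- c * Re (1 / (1 - z)))"
    using exists_flat_filter[of "1 - \<mu>"] assms(2) by auto
  obtain g :: "nat \<Rightarrow> real" where gs: "summable (\<lambda>n. \<bar>g n\<bar>)" and gB: "(\<Sum>n. \<bar>g n\<bar>) \<le> 2 + (1 - \<mu>)"
    and gG: "\<And>z. cmod z < 1 \<Longrightarrow> (\<lambda>n. of_real (g n) * z ^ n) sums ((G z + cnj (G (cnj z))) / 2)"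
    using wiener_le_real_part[OF wG] by blast
  have "(\<lambda>n. complex_of_real (g n) * 0 ^ n) sums 1" using gG[of 0] by (simp add: G0)
  then have "complex_of_real (g 0) = 1" by (simp add: powser_sums_zero_iff)
  then have g0: "g 0 = 1" by simp
  have g: "(\<Sum>k<n. \<bar>g (n - k)\<bar>) \<le> 2 - \<mu>" for n
  proof -
    have "(\<Sum>k<n. \<bar>g (n - k)\<bar>) = (\<Sum>k<n. \<bar>g (Suc k)\<bar>)"
      by (subst sum.nat_diff_reindex[symmetric]) (intro sum.cong, auto simp: Suc_diff_Suc)
    also have "\<dots> = (\<Sum>k<Suc n. \<bar>g k\<bar>) - 1"
      by (subst sum.lessThan_Suc_shift) (simp add: g0)
    also have "(\<Sum>k<Suc n. \<bar>g k\<bar>) \<le> (\<Sum>n. \<bar>g n\<bar>)"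
      by (intro sum_le_suminf gs) auto
    finally show ?thesis using gB by simp
  qed
  \<comment> \<open>The Stolz region and the bound on \<open>G\<close> are invariant under conjugation.\<close>
  have filter_bound: "cmod ((G z + cnj (G (cnj z))) / 2) \<le> K * cmod (1 - z) * exp (- (c / M) / cmod (1 - z))"
    if z: "z \<in> stolz_region M - {1}" for z
  proof -
    have *: "cmod (G w) \<le> K * cmod (1 - w) * exp (- (c / M) / cmod (1 - w))"
      if w: "w \<in> stolz_region M - {1}" for w
    proof -
      have "c * (1 / (M * cmod (1 - w))) \<le> c * Re (1 / (1 - w))"
        using Re_inverse_one_minus_stolz[OF w assms(3)] c by (intro mult_left_mono) auto
      then have "exp (- c * Re (1 / (1 - w))) \<le> exp (- (c / M) / cmod (1 - w))" by simp
      moreover have "cmod w < 1" using stolz_region_subset_disc[OF assms(3)] w by auto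
      ultimately show ?thesis
        using K by (intro order_trans[OF G] mult_left_mono) auto
    qed
    have cn: "cmod (1 - cnj z) = cmod (1 - z)" by (metis complex_cnj_diff complex_cnj_one complex_mod_cnj)
    have "cnj z \<in> stolz_region M - {1}"
      using z cn by (auto simp: stolz_region_def)
    from *[OF this] *[OF z] have "cmod (G z) + cmod (cnj (G (cnj z))) \<le> 2 * (K * cmod (1 - z) * exp (- (c / M) / cmod (1 - z)))"
      unfolding cn by simp
    then show ?thesis using norm_triangle_ineq[of "G z" "cnj (G (cnj z))"] by (simp add: norm_divide)
  qed
  have "\<exists>q :: nat \<Rightarrow> real. (\<forall>n. q n \<in> {-1, 1}) \<and>
      (\<forall>z \<in> stolz_region M - {1}.
        cmod (real_power_series a z - real_power_series q z)
          < (K * M + 1) * exp (- (c / M) / cmod (1 - z)))"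
    \<comment> \<open>The summand 1 makes the inequality strict and the constant positive.\<close>
    if a: "\<forall>n. a n \<in> {-\<mu>..\<mu>}" for a
  proof -
    have a': "\<bar>a n\<bar> \<le> \<mu>" for n using a[rule_format, of n] by auto
    obtain q u where q: "\<And>n. q n \<in> {-1, 1 :: real}" and u: "\<And>n. \<bar>u n\<bar> \<le> (1 :: real)"
      and conv: "\<And>n. a n - q n = (\<Sum>k\<le>n. u k * g (n - k))"
      using exists_one_bit_quantization[of g \<mu> a, OF g0 g a'] by blast
    have "cmod (real_power_series a z - real_power_series q z) < (K * M + 1) * exp (- (c / M) / cmod (1 - z))"
      if z: "z \<in> stolz_region M - {1}" for z
    proof -
      have z1: "cmod z < 1" using stolz_region_subset_disc[OF assms(3)] z by auto
      have sa: "summable (\<lambda>n. complex_of_real (a n) * z ^ n)"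
        by (rule summable_real_power_series[OF a' z1])
      have "\<bar>q n\<bar> \<le> 1" for n using q[of n] by auto
      then have sq: "summable (\<lambda>n. complex_of_real (q n) * z ^ n)"
        by (rule summable_real_power_series[OF _ z1])
      have geo: "(\<lambda>n. cmod z ^ n) sums (1 / (1 - cmod z))" using z1 by (intro geometric_sums) simp
      have ule: "norm (complex_of_real (u n) * z ^ n) \<le> cmod z ^ n" for n
        using u[of n] by (simp add: norm_mult norm_power mult_left_le_one_le)
      have su: "summable (\<lambda>n. norm (complex_of_real (u n) * z ^ n))"
        by (rule summable_comparison_test'[OF sums_summable[OF geo], of 0]) (simp add: ule del: norm_mult)
      have sg: "summable (\<lambda>n. norm (complex_of_real (g n) * z ^ n))"
        using z1 by (intro summable_comparison_test'[OF gs, of 0])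
          (auto simp: norm_mult norm_power intro!: mult_left_le power_le_one)
      have "real_power_series a z - real_power_series q z
          = (\<Sum>n. complex_of_real (a n) * z ^ n - complex_of_real (q n) * z ^ n)"
        unfolding real_power_series_def by (rule suminf_diff[OF sa sq])
      also have "\<dots> = (\<Sum>n. \<Sum>k\<le>n. (complex_of_real (u k) * z ^ k) * (complex_of_real (g (n - k)) * z ^ (n - k)))"
      proof (rule suminf_cong)
        fix n
        have "complex_of_real (a n) * z ^ n - complex_of_real (q n) * z ^ n = complex_of_real (a n - q n) * z ^ n"
          by (simp add: algebra_simps)
        also have "\<dots> = (\<Sum>k\<le>n. complex_of_real (u k * g (n - k)) * z ^ n)"
          by (simp add: conv sum_distrib_right)
        also have "\<dots> = (\<Sum>k\<le>n. (complex_of_real (u k) * z ^ k) * (complex_of_real (g (n - k)) * z ^ (n - k)))"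
        proof (rule sum.cong)
          fix k assume "k \<in> {..n}"
          then have "z ^ n = z ^ k * z ^ (n - k)" by (simp add: power_add[symmetric])
          then show "complex_of_real (u k * g (n - k)) * z ^ n
            = (complex_of_real (u k) * z ^ k) * (complex_of_real (g (n - k)) * z ^ (n - k))" by simp
        qed simp
        finally show "complex_of_real (a n) * z ^ n - complex_of_real (q n) * z ^ n
          = (\<Sum>k\<le>n. (complex_of_real (u k) * z ^ k) * (complex_of_real (g (n - k)) * z ^ (n - k)))" .
      qed
      also have "\<dots> = (\<Sum>n. complex_of_real (u n) * z ^ n) * ((G z + cnj (G (cnj z))) / 2)"
        by (simp only: Cauchy_product[OF su sg, symmetric] sums_unique[OF gG[OF z1]])
      finally have "cmod (real_power_series a z - real_power_series q z)
          = cmod (\<Sum>n. complex_of_real (u n) * z ^ n) * cmod ((G z + cnj (G (cnj z))) / 2)"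
        by (simp only: norm_mult)
      also have "\<dots> \<le> M / cmod (1 - z) * (K * cmod (1 - z) * exp (- (c / M) / cmod (1 - z)))"
      proof (intro mult_mono filter_bound z)
        have "cmod (\<Sum>n. complex_of_real (u n) * z ^ n) \<le> (\<Sum>n. norm (complex_of_real (u n) * z ^ n))"
          by (rule summable_norm[OF su])
        also have "\<dots> \<le> 1 / (1 - cmod z)"
          using suminf_le[OF ule su sums_summable[OF geo]] by (simp only: sums_unique[OF geo, symmetric])
        also have "\<dots> \<le> M / cmod (1 - z)"
          using z z1 by (simp add: stolz_region_def divide_simps)
        finally show "cmod (\<Sum>n. complex_of_real (u n) * z ^ n) \<le> M / cmod (1 - z)" .
      qed (use assms in auto)
      also have "\<dots> = (K * M) * exp (- (c / M) / cmod (1 - z))" using z by simp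
      also have "\<dots> < (K * M + 1) * exp (- (c / M) / cmod (1 - z))" by simp
      finally show ?thesis .
    qed
    with q show ?thesis by blast
  qed
  moreover have "0 < K * M + 1" "0 < c / M" using K c assms by (auto intro: add_nonneg_pos)
  ultimately show ?thesis by blast
qed

end
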